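(* Let $n\ge1$, $b$ an integer and $\mathbf k=(k_1,\dots,k_{\lceil n/2\rceil})$ integers with $k_1<\dots<k_{\lceil n/2\rceil}\le b$. The sum of $2^{\#\text{special entries}}$ over all halved monotone triangles of order $n$ with bottom row $\mathbf k$ and no entry larger than $b$ equals $$4^{\binom{(n+1)/2}{2}}\prod_{1\le i<j\le\frac{n+1}{2}}\frac{(k_j-k_i)(2b+1-k_i-k_j)}{(j-i)(i+j-1)}$$ if $n$ is odd, and $$4^{\binom{n/2}{2}}\prod_{1\le i<j\le\frac n2}\frac{(k_j-k_i)(2b+1-k_i-k_j)}{(j-i)(i+j)}\prod_{i=1}^{n/2}\frac{2b+1-2k_i}{i}$$ if $n$ is even.
   Context: A halved monotone triangle of order $n$ is an array of integers $(a_{i,j})$ indexed by $1\le i\le n$, $1\le j\le\lceil i/2\rceil$ (row $i$ from the top has $\lceil i/2\rceil$ entries; row $n$ is the bottom row) such that $a_{i,j}<a_{i,j+1}$ whenever both exist, and for $1\le i<n$: $a_{i+1,j}\le a_{i,j}$, and $a_{i,j}\le a_{i+1,j+1}$ whenever $a_{i+1,j+1}$ exists. Its bottom row is $(a_{n,1},\dots,a_{n,\lceil n/2\rceil})$. An entry $a_{i,j}$ is special if $a_{i+1,j}$ exists and $a_{i+1,j}<a_{i,j}<a_{i+1,j+1}$ in case $a_{i+1,j+1}$ exists, resp. $a_{i+1,j}<a_{i,j}$ otherwise. *)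

theory Defs
  imports Complex_Main "HOL-Library.FuncSet"
begin

(* (i + 1) div 2 is the ceiling of i / 2. *)
definition row_length :: "nat \<Rightarrow> nat" where
  "row_length i = (i + 1) div 2"

lemma row_length_eq_ceiling: "int (row_length i) = \<lceil>real i / 2\<rceil>"
  unfolding row_length_def
  by (cases "even i") (auto elim!: evenE oddE intro!: ceiling_unique[symmetric] simp: field_simps)

definition hmt_positions :: "nat \<Rightarrow> (nat \<times> nat) set" where
  "hmt_positions n = {(i, j). 1 \<le> i \<and> i \<le> n \<and> 1 \<le> j \<and> j \<le> row_length i}"

(* An array is a function on the positions, made extensional so that distinct
   functions are distinct arrays. *)
definition halved_monotone_triangle :: "nat \<Rightarrow> (nat \<times> nat \<Rightarrow> int) \<Rightarrow> bool" where
  "halved_monotone_triangle n a \<longleftrightarrow>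
     a \<in> extensional (hmt_positions n) \<and>
     (\<forall>i j. (i, j) \<in> hmt_positions n \<and> (i, j + 1) \<in> hmt_positions n
        \<longrightarrow> a (i, j) < a (i, j + 1)) \<and>
     (\<forall>i j. (i, j) \<in> hmt_positions n \<and> i < n
        \<longrightarrow> a (i + 1, j) \<le> a (i, j)) \<and>
     (\<forall>i j. (i, j) \<in> hmt_positions n \<and> i < n \<and> (i + 1, j + 1) \<in> hmt_positions n
        \<longrightarrow> a (i, j) \<le> a (i + 1, j + 1))"

definition special_entries :: "nat \<Rightarrow> (nat \<times> nat \<Rightarrow> int) \<Rightarrow> (nat \<times> nat) set" where
  "special_entries n a =
     {(i, j). (i, j) \<in> hmt_positions n \<and> (i + 1, j) \<in> hmt_positions n \<and>
        a (i + 1, j) < a (i, j) \<and>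
        ((i + 1, j + 1) \<in> hmt_positions n \<longrightarrow> a (i, j) < a (i + 1, j + 1))}"

definition bounded_hmts :: "nat \<Rightarrow> (nat \<Rightarrow> int) \<Rightarrow> int \<Rightarrow> (nat \<times> nat \<Rightarrow> int) set" where
  "bounded_hmts n k b =
     {a. halved_monotone_triangle n a \<and>
         (\<forall>j\<in>{1..row_length n}. a (n, j) = k j) \<and>
         (\<forall>p\<in>hmt_positions n. a p \<le> b)}"

end

theory Submission
  imports Defs "Jordan_Normal_Form.Determinant"
begin

text \<open>
  Removing the bottom row gives a recursion in which the row above is summed over interlacing rows,
  with weight 1 at the ends of each interval and 2 inside. With \<open>x = b + 1/2 - k\<close> the claimed
  product is, up to a constant, the Vandermonde product in the \<open>x\<^sub>i\<^sup>2\<close>, multiplied by all the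
  \<open>x\<^sub>i\<close> when the order is even. It vanishes when two adjacent entries coincide, so the entries of
  the row above may be summed independently. As the product is a determinant in any triangular basis
  of even (resp. odd) polynomials in \<open>x\<close>, the sum is the determinant of the one-variable sums. These
  telescope for the basis \<open>h (x + 1/2) - h (x - 1/2)\<close>, where \<open>h\<close> is a monomial: the weighted sum
  between two bottom entries is the difference of the values of \<open>h (x + 1/2) + h (x - 1/2)\<close>, which
  has the opposite parity.
\<close>

section \<open>Vandermonde-type determinants\<close>

text \<open>Expanding each \<open>P i\<close> in powers of descending degree factors the matrix into
  a coefficient matrix and a Vandermonde matrix. The degree bounds make the coefficient matrix upper
  triangular, so only the coefficients of highest admissible degree survive.\<close>

lemma det_mat_poly_eq:
  fixes P :: "nat \<Rightarrow> 'a :: comm_ring_1 poly"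
  assumes "\<And>i. i < m \<Longrightarrow> degree (P i) \<le> m - 1 - i"
  shows "det (mat m m (\<lambda>(i, j). poly (P i) (y j))) =
    (\<Prod>i<m. coeff (P i) (m - 1 - i)) * det (mat m m (\<lambda>(i, j). y j ^ (m - 1 - i)))"
proof -
  let ?C = "mat m m (\<lambda>(i, r). coeff (P i) (m - 1 - r))"
  let ?V = "mat m m (\<lambda>(i, j). y j ^ (m - 1 - i))"
  have poly: "poly (P i) x = (\<Sum>r<m. coeff (P i) (m - 1 - r) * x ^ (m - 1 - r))" if "i < m" for i x
  proof -
    have "poly (P i) x = (\<Sum>d\<le>m - 1. coeff (P i) d * x ^ d)"
      unfolding poly_altdef using assms[OF that]
      by (intro sum.mono_neutral_left) (auto simp: coeff_eq_0)
    also have "\<dots> = (\<Sum>d<m. coeff (P i) d * x ^ d)"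
      using that by (intro sum.cong) auto
    also have "\<dots> = (\<Sum>r<m. coeff (P i) (m - 1 - r) * x ^ (m - 1 - r))"
      by (subst sum.nat_diff_reindex[symmetric]) (simp add: diff_diff_eq)
    finally show ?thesis .
  qed
  have "mat m m (\<lambda>(i, j). poly (P i) (y j)) = ?C * ?V"
    by (rule eq_matI) (auto simp: poly scalar_prod_def lessThan_atLeast0 intro!: sum.cong)
  then have "det (mat m m (\<lambda>(i, j). poly (P i) (y j))) = det ?C * det ?V"
    by (simp add: det_mult[of _ m])
  moreover have "upper_triangular ?C"
  proof (rule upper_triangularI)
    fix i j assume "j < i" "i < dim_row ?C"
    moreover from this have "degree (P i) < m - 1 - j"
      using assms[of i] by simp
    ultimately show "?C $$ (i, j) = 0" by (simp add: coeff_eq_0)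
  qed
  then have "det ?C = (\<Prod>i<m. coeff (P i) (m - 1 - i))"
    by (subst det_upper_triangular[of _ m])
      (auto simp: prod_list_diag_prod lessThan_atLeast0 intro!: prod.cong)
  ultimately show ?thesis by simp
qed

text \<open>Passing to the Newton basis at the nodes makes the matrix triangular.\<close>

lemma det_vandermonde:
  fixes y :: "nat \<Rightarrow> 'a :: idom"
  shows "det (mat m m (\<lambda>(i, j). y j ^ (m - 1 - i))) = (\<Prod>i<m. \<Prod>j\<in>{i<..<m}. y i - y j)"
proof -
  define Q where "Q i = (\<Prod>r\<in>{i<..<m}. [:- y r, 1:])" for i
  have deg: "degree (Q i) = m - 1 - i" for i
    unfolding Q_def by (subst degree_prod_eq_sum_degree) auto
  have "coeff (Q i) (m - 1 - i) = 1" for i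
    using lead_coeff_prod[of "\<lambda>r. [:- y r, 1:]" "{i<..<m}"] unfolding deg[symmetric]
    by (simp add: Q_def)
  then have "det (mat m m (\<lambda>(i, j). y j ^ (m - 1 - i))) =
      det (mat m m (\<lambda>(i, j). poly (Q i) (y j)))"
    by (subst det_mat_poly_eq) (simp_all add: deg)
  also have "\<dots> = (\<Prod>i<m. poly (Q i) (y i))"
    by (subst det_lower_triangular[of m])
      (auto simp: prod_list_diag_prod lessThan_atLeast0 Q_def poly_prod intro!: prod.cong)
  finally show ?thesis by (simp add: Q_def poly_prod)
qed

lemma det_scale_columns:
  fixes A :: "nat \<Rightarrow> nat \<Rightarrow> 'a :: comm_ring_1"
  shows "det (mat m m (\<lambda>(i, j). c j * A i j)) = (\<Prod>j<m. c j) * det (mat m m (\<lambda>(i, j). A i j))"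
proof -
  have in_range: "p j < m" if "p permutes {0..<m}" "j < m" for p j
    using permutes_in_image[OF that(1), of j] that(2) by simp
  show ?thesis
    by (auto simp: det_col[of _ m] sum_distrib_left in_range prod.distrib mult_ac intro!: sum.cong)
qed

text \<open>The shape used for both parities: \<open>y j\<close> becomes the square of a centred
  entry, and the column factor \<open>c j\<close> is 1 for even polynomials and the entry itself for
  odd ones.\<close>

lemma det_scaled_poly:
  fixes P :: "nat \<Rightarrow> 'a :: idom poly"
  assumes "\<And>i. i < m \<Longrightarrow> degree (P i) \<le> m - 1 - i"
  shows "det (mat m m (\<lambda>(i, j). c j * poly (P i) (y j))) =
    (\<Prod>j<m. c j) * (\<Prod>i<m. coeff (P i) (m - 1 - i)) * (\<Prod>i<m. \<Prod>j\<in>{i<..<m}. y i - y j)"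
  using det_mat_poly_eq[of m P y, OF assms]
  by (simp only: det_scale_columns det_vandermonde mult.assoc)

text \<open>Subtracting the next column is right multiplication by a unipotent lower bidiagonal
  matrix. This removes the differences left by telescoping sums.\<close>

lemma det_column_differences:
  fixes A :: "nat \<Rightarrow> nat \<Rightarrow> 'a :: comm_ring_1"
  shows "det (mat m m (\<lambda>(i, j). if Suc j < m then A i j - A i (Suc j) else A i j)) =
    det (mat m m (\<lambda>(i, j). A i j))"
proof -
  let ?U = "mat m m (\<lambda>(i, j). if i = j then 1 else if i = Suc j then - 1 else 0 :: 'a)"
  have "mat m m (\<lambda>(i, j). if Suc j < m then A i j - A i (Suc j) else A i j) =
      mat m m (\<lambda>(i, j). A i j) * ?U"
  proof (rule eq_matI)
    fix i j assume "i < dim_row (mat m m (\<lambda>(i, j). A i j) * ?U)"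
      and "j < dim_col (mat m m (\<lambda>(i, j). A i j) * ?U)"
    then have ij: "i < m" "j < m" by simp_all
    have "(mat m m (\<lambda>(i, j). A i j) * ?U) $$ (i, j) =
        (\<Sum>r<m. (if r = j then A i r else 0) - (if r = Suc j then A i r else 0))"
      using ij by (auto simp: scalar_prod_def lessThan_atLeast0 intro!: sum.cong)
    also have "\<dots> = (if Suc j < m then A i j - A i (Suc j) else A i j)"
      using ij by (simp add: sum_subtractf)
    finally show "mat m m (\<lambda>(i, j). if Suc j < m then A i j - A i (Suc j) else A i j) $$ (i, j) =
        (mat m m (\<lambda>(i, j). A i j) * ?U) $$ (i, j)"
      using ij by simp
  qed auto
  moreover have "det ?U = 1"
    by (subst det_lower_triangular[of m]) (auto simp: prod_list_diag_prod)
  ultimately show ?thesis by (simp add: det_mult[of _ m])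
qed

text \<open>Laplace expansion along the last row. Read from right to left, it enlarges a matrix of
  one-variable sums by one row and one column.\<close>

lemma det_last_row_unit:
  fixes A :: "nat \<Rightarrow> nat \<Rightarrow> 'a :: comm_ring_1"
  assumes "A m m = 1" and "\<And>j. j < m \<Longrightarrow> A m j = 0"
  shows "det (mat (Suc m) (Suc m) (\<lambda>(i, j). A i j)) = det (mat m m (\<lambda>(i, j). A i j))"
proof -
  let ?M = "mat (Suc m) (Suc m) (\<lambda>(i, j). A i j)"
  have "mat_delete ?M m m = mat m m (\<lambda>(i, j). A i j)"
    by (rule eq_matI) (auto simp: mat_delete_def)
  moreover have "det ?M = (\<Sum>j<Suc m. ?M $$ (m, j) * cofactor ?M m j)"
    by (rule laplace_expansion_row) auto
  ultimately show ?thesis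
    using assms by (simp add: cofactor_def)
qed

text \<open>Each column depends on a single entry of \<open>l\<close>, so every Leibniz term is a
  product over \<open>j\<close> and its sum over a product of ranges factors. Hence the summation
  can be carried out column by column.\<close>

lemma sum_PiE_det:
  fixes f :: "nat \<Rightarrow> 'b \<Rightarrow> 'a :: comm_ring_1"
  assumes "\<And>j. j \<in> {1..m} \<Longrightarrow> finite (B j)"
  shows "(\<Sum>l\<in>PiE {1..m} B. (\<Prod>j\<in>{1..m}. w j (l j)) * det (mat m m (\<lambda>(i, j). f i (l (Suc j))))) =
    det (mat m m (\<lambda>(i, j). \<Sum>t\<in>B (Suc j). w (Suc j) t * f i t))"
proof -
  have in_range: "p j < m" if "p permutes {0..<m}" "j < m" for p j
    using permutes_in_image[OF that(1), of j] that(2) by simp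
  \<comment> \<open>Matrix columns count from 0, row entries from 1.\<close>
  have shift: "(\<Prod>j<m. g (Suc j)) = (\<Prod>j\<in>{1..m}. g j)" for g :: "nat \<Rightarrow> 'a"
    by (rule prod.reindex_bij_witness[of _ "\<lambda>j. j - 1" Suc]) auto
  have "(\<Sum>l\<in>PiE {1..m} B. (\<Prod>j\<in>{1..m}. w j (l j)) * det (mat m m (\<lambda>(i, j). f i (l (Suc j))))) =
     (\<Sum>l\<in>PiE {1..m} B. \<Sum>p | p permutes {0..<m}.
        signof p * (\<Prod>j\<in>{1..m}. w j (l j) * f (p (j - 1)) (l j)))"
  proof (rule sum.cong[OF refl])
    fix l
    have "(\<Prod>j<m. mat m m (\<lambda>(i, j). f i (l (Suc j))) $$ (p j, j)) =
        (\<Prod>j\<in>{1..m}. f (p (j - 1)) (l j))" if "p permutes {0..<m}" for p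
      unfolding shift[symmetric] using that by (intro prod.cong) (auto simp: in_range)
    then show "(\<Prod>j\<in>{1..m}. w j (l j)) * det (mat m m (\<lambda>(i, j). f i (l (Suc j)))) =
        (\<Sum>p | p permutes {0..<m}. signof p * (\<Prod>j\<in>{1..m}. w j (l j) * f (p (j - 1)) (l j)))"
      by (subst det_col[of _ m])
        (auto simp: sum_distrib_left prod.distrib mult_ac intro!: sum.cong)
  qed
  also have "\<dots> = (\<Sum>p | p permutes {0..<m}. signof p *
      (\<Sum>l\<in>PiE {1..m} B. \<Prod>j\<in>{1..m}. w j (l j) * f (p (j - 1)) (l j)))"
    by (subst sum.swap) (simp add: sum_distrib_left)
  also have "\<dots> = (\<Sum>p | p permutes {0..<m}. signof p *
      (\<Prod>j\<in>{1..m}. \<Sum>t\<in>B j. w j t * f (p (j - 1)) t))"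
    using assms by (subst prod_sum_PiE) auto
  also have "\<dots> = det (mat m m (\<lambda>(i, j). \<Sum>t\<in>B (Suc j). w (Suc j) t * f i t))"
    unfolding shift[symmetric]
    by (subst det_col[of _ m]) (auto simp: in_range intro!: sum.cong prod.cong)
  finally show ?thesis .
qed

section \<open>Summation over one row\<close>

text \<open>Multiplying the two powers by \<open>x + 1/2\<close> and \<open>x - 1/2\<close> mixes
  their sum and their difference. This recursion carries parities and leading coefficients from one
  exponent to the next.\<close>

lemma shifted_power_Suc:
  fixes x :: real
  shows "(x + 1/2) ^ Suc e + (x - 1/2) ^ Suc e =
      x * ((x + 1/2) ^ e + (x - 1/2) ^ e) + ((x + 1/2) ^ e - (x - 1/2) ^ e) / 2"
    and "(x + 1/2) ^ Suc e - (x - 1/2) ^ Suc e =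
      x * ((x + 1/2) ^ e - (x - 1/2) ^ e) + ((x + 1/2) ^ e + (x - 1/2) ^ e) / 2"
  by (simp_all add: algebra_simps add_divide_distrib diff_divide_distrib)

text \<open>Parity in \<open>x\<close> is recorded by polynomials in the square of \<open>x\<close>.
  \<open>A\<close> will supply the summands and \<open>B\<close> their telescoping partners. A
  degree bound plus one coefficient is what the triangular determinant consumes.\<close>

definition odd_shift_polys :: "nat \<Rightarrow> real poly \<Rightarrow> real poly \<Rightarrow> bool" where
  "odd_shift_polys i A B \<longleftrightarrow>
    degree A \<le> i \<and> coeff A i = 2 * real i + 1 \<and> degree B \<le> i \<and> coeff B i = 2 \<and>
    (\<forall>x. (x + 1/2) ^ (2 * i + 1) - (x - 1/2) ^ (2 * i + 1) = poly A (x\<^sup>2)) \<and>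
    (\<forall>x. (x + 1/2) ^ (2 * i + 1) + (x - 1/2) ^ (2 * i + 1) = x * poly B (x\<^sup>2))"

definition even_shift_polys :: "nat \<Rightarrow> real poly \<Rightarrow> real poly \<Rightarrow> bool" where
  "even_shift_polys i E C \<longleftrightarrow>
    degree E \<le> i \<and> coeff E i = 2 * real i + 2 \<and> degree C \<le> i + 1 \<and> coeff C (i + 1) = 2 \<and>
    (\<forall>x. (x + 1/2) ^ (2 * i + 2) - (x - 1/2) ^ (2 * i + 2) = x * poly E (x\<^sup>2)) \<and>
    (\<forall>x. (x + 1/2) ^ (2 * i + 2) + (x - 1/2) ^ (2 * i + 2) = poly C (x\<^sup>2))"

text \<open>One step of \<open>shifted_power_Suc\<close>, where \<open>pCons 0\<close> multiplies by
  the square of \<open>x\<close>. The leading coefficient of the difference gains half of that of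
  the sum, hence 1, while that of the sum stays 2. The step from even to odd exponents works in the
  same way.\<close>

lemma even_shift_polys_from_odd:
  assumes "odd_shift_polys i A B"
  shows "even_shift_polys i (A + smult (1/2) B) (pCons 0 B + smult (1/2) A)"
proof -
  have deg: "degree A \<le> i" "degree B \<le> i" and lead: "coeff A i = 2 * real i + 1" "coeff B i = 2"
    and D: "\<And>x. (x + 1/2) ^ (2 * i + 1) - (x - 1/2) ^ (2 * i + 1) = poly A (x\<^sup>2)"
    and S: "\<And>x. (x + 1/2) ^ (2 * i + 1) + (x - 1/2) ^ (2 * i + 1) = x * poly B (x\<^sup>2)"
    using assms by (simp_all add: odd_shift_polys_def)
  have "(x + 1/2) ^ (2 * i + 2) - (x - 1/2) ^ (2 * i + 2) = x * poly (A + smult (1/2) B) (x\<^sup>2)"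
    for x
    using shifted_power_Suc(2)[of x "2 * i + 1"] unfolding D S by (simp add: algebra_simps)
  moreover have "(x + 1/2) ^ (2 * i + 2) + (x - 1/2) ^ (2 * i + 2) =
      poly (pCons 0 B + smult (1/2) A) (x\<^sup>2)" for x
    using shifted_power_Suc(1)[of x "2 * i + 1"] unfolding D S by (simp add: power2_eq_square)
  moreover have "degree (A + smult (1/2) B) \<le> i" "degree (pCons 0 B + smult (1/2) A) \<le> i + 1"
    using deg by (auto intro!: degree_add_le intro: order.trans[OF degree_pCons_le])
  ultimately show ?thesis
    using deg lead by (simp add: even_shift_polys_def coeff_eq_0)
qed

lemma odd_shift_polys_from_even:
  assumes "even_shift_polys i E C"
  shows "odd_shift_polys (Suc i) (pCons 0 E + smult (1/2) C) (C + smult (1/2) E)"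
proof -
  have deg: "degree E \<le> i" "degree C \<le> i + 1"
    and lead: "coeff E i = 2 * real i + 2" "coeff C (i + 1) = 2"
    and D: "\<And>x. (x + 1/2) ^ (2 * i + 2) - (x - 1/2) ^ (2 * i + 2) = x * poly E (x\<^sup>2)"
    and S: "\<And>x. (x + 1/2) ^ (2 * i + 2) + (x - 1/2) ^ (2 * i + 2) = poly C (x\<^sup>2)"
    using assms by (simp_all add: even_shift_polys_def)
  have exp: "2 * Suc i + 1 = Suc (2 * i + 2)" by simp
  have "(x + 1/2) ^ (2 * Suc i + 1) - (x - 1/2) ^ (2 * Suc i + 1) =
      poly (pCons 0 E + smult (1/2) C) (x\<^sup>2)" for x
    unfolding exp shifted_power_Suc D S by (simp add: power2_eq_square)
  moreover have "(x + 1/2) ^ (2 * Suc i + 1) + (x - 1/2) ^ (2 * Suc i + 1) =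
      x * poly (C + smult (1/2) E) (x\<^sup>2)" for x
    unfolding exp shifted_power_Suc D S by (simp add: algebra_simps)
  moreover have "degree (pCons 0 E + smult (1/2) C) \<le> Suc i" "degree (C + smult (1/2) E) \<le> Suc i"
    using deg by (auto intro!: degree_add_le intro: order.trans[OF degree_pCons_le])
  ultimately show ?thesis
    using deg lead by (simp add: odd_shift_polys_def coeff_eq_0)
qed

lemma odd_shift_polys_exist: "\<exists>A B. odd_shift_polys i A B"
proof (induction i)
  case 0
  have "odd_shift_polys 0 [:1:] [:2:]" by (simp add: odd_shift_polys_def)
  then show ?case by blast
next
  case (Suc i)
  then show ?case using even_shift_polys_from_odd odd_shift_polys_from_even by blast
qed

lemma even_shift_polys_exist: "\<exists>E C. even_shift_polys i E C"
  using odd_shift_polys_exist even_shift_polys_from_odd by blast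

section \<open>Telescoping trapezoidal sums\<close>

text \<open>Adding the hypothesis over all \<open>t\<close> from \<open>p\<close> to
  \<open>q - 1\<close> telescopes on the right and counts every inner term twice but the ends once
  on the left.\<close>

lemma sum_trapezoid:
  fixes f G :: "int \<Rightarrow> real"
  assumes step: "\<And>t. f t + f (t + 1) = G t - G (t + 1)" and "p \<le> q"
  shows "2 * (\<Sum>t\<in>{p..q}. f t) = f p + f q + G p - G q"
  using \<open>p \<le> q\<close>
proof (induction q rule: int_ge_induct)
  case base
  show ?case by simp
next
  case (step q)
  have "{p..q + 1} = insert (q + 1) {p..q}" using step.hyps by auto
  then show ?case using step.IH assms(1)[of q] by simp
qed

text \<open>The weights of special and non-special entries are exactly those of the trapezoidal
  rule. For \<open>p < q\<close> the two ends are different terms, and each loses one of its two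
  copies.\<close>

lemma sum_trapezoid_interval:
  fixes f G :: "int \<Rightarrow> real"
  assumes "\<And>t. f t + f (t + 1) = G t - G (t + 1)" and "p < q"
  shows "(\<Sum>t\<in>{p..q}. (if p < t \<and> t < q then 2 else 1) * f t) = G p - G q"
proof -
  have "(\<Sum>t\<in>{p..q}. (if p < t \<and> t < q then 2 else 1) * f t) =
      (\<Sum>t\<in>{p..q}. 2 * f t - (if t = p then f t else 0) - (if t = q then f t else 0))"
    using \<open>p < q\<close> by (intro sum.cong) auto
  also have "\<dots> = 2 * (\<Sum>t\<in>{p..q}. f t) - f p - f q"
    using \<open>p < q\<close> by (simp add: sum_subtractf sum_distrib_left)
  finally show ?thesis using sum_trapezoid[of f G p q, OF assms(1)] \<open>p < q\<close> by simp
qed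

text \<open>Models a last entry that has only \<open>b\<close> above it, so that the right end also
  has weight 2. The boundary condition \<open>f q = G q\<close> absorbs the additional copy, and the
  upper limit leaves no trace in the result.\<close>

lemma sum_trapezoid_half_open:
  fixes f G :: "int \<Rightarrow> real"
  assumes "\<And>t. f t + f (t + 1) = G t - G (t + 1)" and "f q = G q" and "p \<le> q"
  shows "(\<Sum>t\<in>{p..q}. (if p < t then 2 else 1) * f t) = G p"
proof -
  have "(\<Sum>t\<in>{p..q}. (if p < t then 2 else 1) * f t) =
      (\<Sum>t\<in>{p..q}. 2 * f t - (if t = p then f t else 0))"
    by (intro sum.cong) auto
  also have "\<dots> = 2 * (\<Sum>t\<in>{p..q}. f t) - f p"
    using \<open>p \<le> q\<close> by (simp add: sum_subtractf sum_distrib_left)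
  finally show ?thesis using sum_trapezoid[of f G p q, OF assms(1)] assms by simp
qed

section \<open>Products over pairs of indices\<close>

definition index_pairs :: "nat \<Rightarrow> (nat \<times> nat) set" where
  "index_pairs m = {(i, j). 1 \<le> i \<and> i < j \<and> j \<le> m}"

lemma finite_index_pairs: "finite (index_pairs m)"
  by (rule finite_subset[of _ "{..m} \<times> {..m}"]) (auto simp: index_pairs_def)

lemma index_pairs_0 [simp]: "index_pairs 0 = {}"
  by (auto simp: index_pairs_def)

text \<open>Transfers the Vandermonde product from 0-based matrix indices to 1-based row
  entries.\<close>

lemma prod_index_pairs_shift:
  "(\<Prod>i<m. \<Prod>j\<in>{i<..<m}. h (Suc i) (Suc j)) = (\<Prod>(i, j)\<in>index_pairs m. h i j)"
  by (subst prod.Sigma)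
    (auto simp: index_pairs_def
      intro!: prod.reindex_bij_witness[of _ "\<lambda>(i, j). (i - 1, j - 1)" "\<lambda>(i, j). (Suc i, Suc j)"])

lemma prod_index_pairs_Suc:
  "(\<Prod>(i, j)\<in>index_pairs (Suc m). h i j) = (\<Prod>(i, j)\<in>index_pairs m. h i j) * (\<Prod>i\<in>{1..m}. h i (Suc m))"
proof -
  have "index_pairs (Suc m) = index_pairs m \<union> (\<lambda>i. (i, Suc m)) ` {1..m}"
    by (auto simp: index_pairs_def)
  moreover have "index_pairs m \<inter> (\<lambda>i. (i, Suc m)) ` {1..m} = {}"
    by (auto simp: index_pairs_def)
  ultimately show ?thesis
    by (simp add: finite_index_pairs prod.union_disjoint prod.reindex inj_on_def)
qed

lemma prod_lessThan_Suc_shift_atLeastAtMost: "(\<Prod>j<m. h (Suc j)) = (\<Prod>j\<in>{1..m}. h j)"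
  by (rule prod.reindex_bij_witness[of _ "\<lambda>j. j - 1" Suc]) auto

text \<open>\<open>b + 1/2\<close> is the centre of the reflection \<open>t \<mapsto> 2 b + 1 - t\<close>, under which the factors of the
  product formulas are even or odd in each \<open>k\<^sub>i\<close>.\<close>

definition centred :: "int \<Rightarrow> int \<Rightarrow> real" where
  "centred b t = real_of_int b + 1/2 - real_of_int t"

text \<open>Increasing \<open>t\<close> by 1 lowers the centred value by 1, so the lower power at
  \<open>t\<close> is the upper power at \<open>t + 1\<close> and cancels on both sides. At
  \<open>t = b\<close> the centred value is 1/2, and the lower power is a positive power of
  0.\<close>

lemma trapezoid_pair:
  fixes b :: int and e :: nat
  defines "f \<equiv> (\<lambda>t. (centred b t + 1/2) ^ e - (centred b t - 1/2) ^ e)"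
    and "G \<equiv> (\<lambda>t. (centred b t + 1/2) ^ e + (centred b t - 1/2) ^ e)"
  shows "f t + f (t + 1) = G t - G (t + 1)" and "e > 0 \<Longrightarrow> f b = G b"
proof -
  have "centred b (t + 1) = centred b t - 1" by (simp add: centred_def)
  then show "f t + f (t + 1) = G t - G (t + 1)" unfolding f_def G_def by simp
qed (simp add: f_def G_def centred_def)

section \<open>The two row summations\<close>

text \<open>The passage to an even order: both rows have \<open>m\<close> entries, so the last upper
  entry is limited only by \<open>b\<close>. The summand is even in each centred entry and the
  result is odd. The factors \<open>2 * real i + 1\<close> and 2 are the leading coefficients of the
  two polynomial bases.\<close>

lemma even_row_summation:
  fixes k :: "nat \<Rightarrow> int"
  assumes inc: "\<And>j. 1 \<le> j \<Longrightarrow> j < m \<Longrightarrow> k j < k (Suc j)" and le: "\<And>j. j \<in> {1..m} \<Longrightarrow> k j \<le> b"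
  shows "(\<Prod>i<m. 2 * real i + 1) *
      (\<Sum>l\<in>(\<Pi>\<^sub>E j\<in>{1..m}. {k j..if j < m then k (Suc j) else b}).
        (\<Prod>j\<in>{1..m}. if k j < l j \<and> (j < m \<longrightarrow> l j < k (Suc j)) then 2 else 1) *
        (\<Prod>(i, j)\<in>index_pairs m. (centred b (l i))\<^sup>2 - (centred b (l j))\<^sup>2)) =
    2 ^ m * (\<Prod>(i, j)\<in>index_pairs m. (centred b (k i))\<^sup>2 - (centred b (k j))\<^sup>2) *
      (\<Prod>j\<in>{1..m}. centred b (k j))"
proof -
  obtain A B where "\<And>i. odd_shift_polys i (A i) (B i)"
    using odd_shift_polys_exist by metis
  then have A: "\<And>i. degree (A i) \<le> i" "\<And>i. coeff (A i) i = 2 * real i + 1"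
    and B: "\<And>i. degree (B i) \<le> i" "\<And>i. coeff (B i) i = 2"
    and D: "\<And>i x. (x + 1/2) ^ (2 * i + 1) - (x - 1/2) ^ (2 * i + 1) = poly (A i) (x\<^sup>2)"
    and S: "\<And>i x. (x + 1/2) ^ (2 * i + 1) + (x - 1/2) ^ (2 * i + 1) = x * poly (B i) (x\<^sup>2)"
    unfolding odd_shift_polys_def by blast+
  \<comment> \<open>The index \<open>m - 1 - i\<close> makes the degrees descend along the rows, as
    in the Vandermonde matrix.\<close>
  define f where "f i t = poly (A (m - 1 - i)) ((centred b t)\<^sup>2)" for i t
  define G where "G i t = centred b t * poly (B (m - 1 - i)) ((centred b t)\<^sup>2)" for i t
  define w :: "nat \<Rightarrow> int \<Rightarrow> real"
    where "w j t = (if k j < t \<and> (j < m \<longrightarrow> t < k (Suc j)) then 2 else 1)" for j t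
  define I where "I j = {k j..if j < m then k (Suc j) else b}" for j
  have step: "f i t + f i (t + 1) = G i t - G i (t + 1)" and bd: "f i b = G i b" for i t
    unfolding f_def G_def D[symmetric] S[symmetric]
    by (rule trapezoid_pair) (rule trapezoid_pair, simp)
  have odd: "(\<Prod>i<m. 2 * real (m - 1 - i) + 1) = (\<Prod>i<m. 2 * real i + 1)"
    using prod.nat_diff_reindex[of "\<lambda>i. 2 * real i + 1" m] by (simp add: diff_diff_eq)
  have detf: "det (mat m m (\<lambda>(i, j). f i (l (Suc j)))) = (\<Prod>i<m. 2 * real i + 1) *
      (\<Prod>(i, j)\<in>index_pairs m. (centred b (l i))\<^sup>2 - (centred b (l j))\<^sup>2)" for l
    using det_scaled_poly[of m "\<lambda>i. A (m - 1 - i)" "\<lambda>_. 1" "\<lambda>j. (centred b (l (Suc j)))\<^sup>2", OF A(1)]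
    unfolding A(2) f_def odd prod_index_pairs_shift[symmetric] by simp
  have detG: "det (mat m m (\<lambda>(i, j). G i (k (Suc j)))) =
      2 ^ m * (\<Prod>(i, j)\<in>index_pairs m. (centred b (k i))\<^sup>2 - (centred b (k j))\<^sup>2) *
      (\<Prod>j\<in>{1..m}. centred b (k j))"
    using det_scaled_poly[of m "\<lambda>i. B (m - 1 - i)" "\<lambda>j. centred b (k (Suc j))"
        "\<lambda>j. (centred b (k (Suc j)))\<^sup>2", OF B(1)]
    unfolding B(2) G_def prod_index_pairs_shift[symmetric]
      prod_lessThan_Suc_shift_atLeastAtMost[symmetric] by simp
  \<comment> \<open>All columns but the last run between two neighbours of \<open>k\<close> and give
    differences. The last one runs up to \<open>b\<close> and, because \<open>f i b = G i b\<close>,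
    gives a single value. This is exactly the pattern of
    \<open>det_column_differences\<close>.\<close>
  have col: "(\<Sum>t\<in>I (Suc j). w (Suc j) t * f i t) =
      (if Suc j < m then G i (k (Suc j)) - G i (k (Suc (Suc j))) else G i (k (Suc j)))"
    if "j < m" for i j
  proof (cases "Suc j < m")
    case True
    then show ?thesis
      using sum_trapezoid_interval[of "f i" "G i", OF step inc[of "Suc j"]]
      by (simp add: I_def w_def)
  next
    case False
    then show ?thesis
      using sum_trapezoid_half_open[of "f i" "G i" b "k (Suc j)", OF step bd] le[of "Suc j"] that
      by (simp add: I_def w_def)
  qed
  have "(\<Prod>i<m. 2 * real i + 1) * (\<Sum>l\<in>PiE {1..m} I. (\<Prod>j\<in>{1..m}. w j (l j)) *
      (\<Prod>(i, j)\<in>index_pairs m. (centred b (l i))\<^sup>2 - (centred b (l j))\<^sup>2)) =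
    (\<Sum>l\<in>PiE {1..m} I. (\<Prod>j\<in>{1..m}. w j (l j)) * det (mat m m (\<lambda>(i, j). f i (l (Suc j)))))"
    unfolding detf sum_distrib_left by (simp add: mult_ac)
  also have "\<dots> = det (mat m m (\<lambda>(i, j). \<Sum>t\<in>I (Suc j). w (Suc j) t * f i t))"
    by (rule sum_PiE_det) (simp add: I_def)
  also have "mat m m (\<lambda>(i, j). \<Sum>t\<in>I (Suc j). w (Suc j) t * f i t) =
      mat m m (\<lambda>(i, j). if Suc j < m then G i (k (Suc j)) - G i (k (Suc (Suc j))) else G i (k (Suc j)))"
    by (rule eq_matI) (simp_all add: col)
  also have "det \<dots> = det (mat m m (\<lambda>(i, j). G i (k (Suc j))))"
    by (rule det_column_differences)
  finally show ?thesis
    unfolding detG w_def I_def .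
qed

text \<open>The passage to an odd order: the lower row has one entry more, so every upper entry lies
  between two lower ones. The \<open>m\<close> columns are then differences of \<open>m + 1\<close>
  values, and the constant polynomial is adjoined to obtain a square matrix of size
  \<open>Suc m\<close>. Here the summand is odd in each centred entry and the result is
  even.\<close>

lemma odd_row_summation:
  fixes k :: "nat \<Rightarrow> int"
  assumes inc: "\<And>j. 1 \<le> j \<Longrightarrow> j \<le> m \<Longrightarrow> k j < k (Suc j)"
  shows "(\<Prod>i<m. 2 * real i + 2) *
      (\<Sum>l\<in>(\<Pi>\<^sub>E j\<in>{1..m}. {k j..k (Suc j)}).
        (\<Prod>j\<in>{1..m}. if k j < l j \<and> l j < k (Suc j) then 2 else 1) *
        ((\<Prod>(i, j)\<in>index_pairs m. (centred b (l i))\<^sup>2 - (centred b (l j))\<^sup>2) *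
         (\<Prod>j\<in>{1..m}. centred b (l j)))) =
    2 ^ m * (\<Prod>(i, j)\<in>index_pairs (Suc m). (centred b (k i))\<^sup>2 - (centred b (k j))\<^sup>2)"
proof -
  obtain E C where "\<And>i. even_shift_polys i (E i) (C i)"
    using even_shift_polys_exist by metis
  then have E: "\<And>i. degree (E i) \<le> i" "\<And>i. coeff (E i) i = 2 * real i + 2"
    and C: "\<And>i. degree (C i) \<le> i + 1" "\<And>i. coeff (C i) (i + 1) = 2"
    and D: "\<And>i x. (x + 1/2) ^ (2 * i + 2) - (x - 1/2) ^ (2 * i + 2) = x * poly (E i) (x\<^sup>2)"
    and S: "\<And>i x. (x + 1/2) ^ (2 * i + 2) + (x - 1/2) ^ (2 * i + 2) = poly (C i) (x\<^sup>2)"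
    unfolding even_shift_polys_def by blast+
  \<comment> \<open>For \<open>i < m\<close> the degrees are \<open>m\<close> down to 1, since
    \<open>C i\<close> has degree \<open>i + 1\<close>. The constant 1 fills the missing degree 0
    and has no partner \<open>f\<close>.\<close>
  define P where "P i = (if i < m then C (m - 1 - i) else 1)" for i
  define f where "f i t = centred b t * poly (E (m - 1 - i)) ((centred b t)\<^sup>2)" for i t
  define G where "G i t = poly (P i) ((centred b t)\<^sup>2)" for i t
  \<comment> \<open>The columns \<open>j < m\<close> are the one-variable sums. Column
    \<open>m\<close> is the additional one, left undifferenced so that
    \<open>det_column_differences\<close> applies at size \<open>Suc m\<close>.\<close>
  define H where "H i j = (if Suc j < Suc m then G i (k (Suc j)) - G i (k (Suc (Suc j)))
      else G i (k (Suc j)))" for i j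
  define w :: "nat \<Rightarrow> int \<Rightarrow> real"
    where "w j t = (if k j < t \<and> t < k (Suc j) then 2 else 1)" for j t
  define I where "I j = {k j..k (Suc j)}" for j
  have step: "f i t + f i (t + 1) = G i t - G i (t + 1)" if "i < m" for i t
    using that
    by (simp only: f_def G_def P_def if_True D[symmetric] S[symmetric] trapezoid_pair(1))
  have even: "(\<Prod>i<m. 2 * real (m - 1 - i) + 2) = (\<Prod>i<m. 2 * real i + 2)"
    using prod.nat_diff_reindex[of "\<lambda>i. 2 * real i + 2" m] by (simp add: diff_diff_eq)
  have detf: "det (mat m m (\<lambda>(i, j). f i (l (Suc j)))) = (\<Prod>i<m. 2 * real i + 2) *
      ((\<Prod>(i, j)\<in>index_pairs m. (centred b (l i))\<^sup>2 - (centred b (l j))\<^sup>2) *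
       (\<Prod>j\<in>{1..m}. centred b (l j)))" for l
    using det_scaled_poly[of m "\<lambda>i. E (m - 1 - i)" "\<lambda>j. centred b (l (Suc j))"
        "\<lambda>j. (centred b (l (Suc j)))\<^sup>2", OF E(1)]
    unfolding E(2) f_def even prod_index_pairs_shift[symmetric]
      prod_lessThan_Suc_shift_atLeastAtMost[symmetric] by (simp add: mult_ac)
  have degP: "degree (P i) \<le> Suc m - 1 - i" if "i < Suc m" for i
    using C(1)[of "m - 1 - i"] by (auto simp: P_def)
  have leadP: "(\<Prod>i<Suc m. coeff (P i) (Suc m - 1 - i)) = 2 ^ m"
  proof -
    have "coeff (P i) (m - i) = 2" if "i < m" for i
    proof -
      have "m - i = (m - 1 - i) + 1" using that by simp
      then show ?thesis using that C(2)[of "m - 1 - i"] by (simp add: P_def)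
    qed
    then show ?thesis by (simp add: P_def[of m])
  qed
  have detG: "det (mat (Suc m) (Suc m) (\<lambda>(i, j). G i (k (Suc j)))) =
      2 ^ m * (\<Prod>(i, j)\<in>index_pairs (Suc m). (centred b (k i))\<^sup>2 - (centred b (k j))\<^sup>2)"
    using det_scaled_poly[of "Suc m" P "\<lambda>_. 1" "\<lambda>j. (centred b (k (Suc j)))\<^sup>2", OF degP]
    unfolding leadP G_def prod_index_pairs_shift[symmetric] by simp
  have col: "(\<Sum>t\<in>I (Suc j). w (Suc j) t * f i t) = H i j" if "i < m" "j < m" for i j
    using sum_trapezoid_interval[of "f i" "G i", OF step[OF that(1)] inc[of "Suc j"]] that
    by (simp add: I_def w_def H_def)
  have "(\<Prod>i<m. 2 * real i + 2) * (\<Sum>l\<in>PiE {1..m} I. (\<Prod>j\<in>{1..m}. w j (l j)) *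
      ((\<Prod>(i, j)\<in>index_pairs m. (centred b (l i))\<^sup>2 - (centred b (l j))\<^sup>2) *
       (\<Prod>j\<in>{1..m}. centred b (l j)))) =
    (\<Sum>l\<in>PiE {1..m} I. (\<Prod>j\<in>{1..m}. w j (l j)) * det (mat m m (\<lambda>(i, j). f i (l (Suc j)))))"
    unfolding detf sum_distrib_left by (simp add: mult_ac)
  also have "\<dots> = det (mat m m (\<lambda>(i, j). \<Sum>t\<in>I (Suc j). w (Suc j) t * f i t))"
    by (rule sum_PiE_det) (simp add: I_def)
  also have "mat m m (\<lambda>(i, j). \<Sum>t\<in>I (Suc j). w (Suc j) t * f i t) = mat m m (\<lambda>(i, j). H i j)"
    by (rule eq_matI) (simp_all add: col)
  \<comment> \<open>The row of the constant polynomial \<open>1\<close> becomes a unit vector under column differences.\<close>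
  also have "det \<dots> = det (mat (Suc m) (Suc m) (\<lambda>(i, j). H i j))"
    by (rule det_last_row_unit[symmetric]) (simp_all add: H_def G_def P_def)
  also have "\<dots> = det (mat (Suc m) (Suc m) (\<lambda>(i, j). G i (k (Suc j))))"
    unfolding H_def by (rule det_column_differences)
  finally show ?thesis
    unfolding detG w_def I_def .
qed

section \<open>Removing the bottom row\<close>

text \<open>Only weak interlacing is imposed, so that the set is a product of intervals. Strict
  increase is added separately. The bound \<open>b\<close> replaces the missing right neighbour of a
  last entry.\<close>

definition interlacing_rows :: "nat \<Rightarrow> (nat \<Rightarrow> int) \<Rightarrow> int \<Rightarrow> (nat \<Rightarrow> int) set" where
  "interlacing_rows n k b =
    (\<Pi>\<^sub>E j\<in>{1..row_length n}. {k j..if j < row_length (Suc n) then k (Suc j) else b})"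

text \<open>The factors 2 mark the entries of row \<open>n\<close> that become special once
  \<open>k\<close> is placed below.\<close>

definition row_weight :: "nat \<Rightarrow> (nat \<Rightarrow> int) \<Rightarrow> (nat \<Rightarrow> int) \<Rightarrow> real" where
  "row_weight n k l = (\<Prod>j\<in>{1..row_length n}.
     if k j < l j \<and> (j < row_length (Suc n) \<longrightarrow> l j < k (Suc j)) then 2 else 1)"

definition increasing_row :: "nat \<Rightarrow> (nat \<Rightarrow> int) \<Rightarrow> bool" where
  "increasing_row m l \<longleftrightarrow> (\<forall>j. 1 \<le> j \<and> j < m \<longrightarrow> l j < l (Suc j))"

text \<open>Restricted to its index range so that it can belong to the extensional product
  \<open>interlacing_rows\<close>.\<close>

definition row_of :: "nat \<Rightarrow> (nat \<times> nat \<Rightarrow> int) \<Rightarrow> nat \<Rightarrow> int" where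
  "row_of n a = (\<lambda>j\<in>{1..row_length n}. a (n, j))"

definition add_row :: "nat \<Rightarrow> (nat \<Rightarrow> int) \<Rightarrow> (nat \<times> nat \<Rightarrow> int) \<Rightarrow> nat \<times> nat \<Rightarrow> int" where
  "add_row n k a = (\<lambda>(i, j)\<in>hmt_positions (Suc n). if i = Suc n then k j else a (i, j))"

lemma hmt_positions_iff: "(i, j) \<in> hmt_positions n \<longleftrightarrow> 1 \<le> i \<and> i \<le> n \<and> 1 \<le> j \<and> j \<le> row_length i"
  by (simp add: hmt_positions_def)

lemma row_length_mono: "i \<le> i' \<Longrightarrow> row_length i \<le> row_length i'"
  unfolding row_length_def by (intro div_le_mono) simp

lemma hmt_positions_Suc_iff:
  "(i, j) \<in> hmt_positions (Suc n) \<longleftrightarrow>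
    (i, j) \<in> hmt_positions n \<or> (i = Suc n \<and> 1 \<le> j \<and> j \<le> row_length (Suc n))"
  by (auto simp: hmt_positions_iff le_Suc_eq)

lemma finite_hmt_positions: "finite (hmt_positions n)"
  by (rule finite_subset[of _ "{..n} \<times> {..row_length n}"])
    (auto simp: hmt_positions_def intro: order.trans[OF _ row_length_mono])

lemma add_row_above: "(i, j) \<in> hmt_positions n \<Longrightarrow> add_row n k a (i, j) = a (i, j)"
  by (auto simp: add_row_def hmt_positions_iff)

lemma add_row_bottom: "1 \<le> j \<Longrightarrow> j \<le> row_length (Suc n) \<Longrightarrow> add_row n k a (Suc n, j) = k j"
  by (simp add: add_row_def hmt_positions_iff)

text \<open>Being special involves only the row below. Rows above row \<open>n\<close> are therefore
  unaffected, row \<open>n\<close> had no special entries as a bottom row and acquires those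
  determined by \<open>k\<close>, and the new bottom row has none.\<close>

lemma special_entries_add_row:
  "special_entries (Suc n) (add_row n k a) = special_entries n a \<union>
    (\<lambda>j. (n, j)) ` {j \<in> {1..row_length n}. k j < row_of n a j \<and>
      (j < row_length (Suc n) \<longrightarrow> row_of n a j < k (Suc j))}" (is "?L = _ \<union> ?R")
proof -
  have "(i, j) \<in> ?L \<longleftrightarrow> (i, j) \<in> special_entries n a \<or> (i, j) \<in> ?R" for i j
  proof (cases "i = n")
    case True
    \<comment> \<open>Row 0 is empty, so an entry in row \<open>n\<close> forces \<open>n\<close> to
      be positive, as membership in \<open>hmt_positions\<close> requires.\<close>
    have "0 < n" if "0 < j" "j \<le> row_length n"
      using that by (cases n) (simp_all add: row_length_def)
    with True show ?thesis
      using row_length_mono[of n "Suc n"]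
      by (auto simp: special_entries_def hmt_positions_iff row_of_def add_row_above add_row_bottom
          Suc_le_eq)
  next
    case False
    then show ?thesis
      by (auto simp: special_entries_def hmt_positions_Suc_iff add_row_above)
        (auto simp: hmt_positions_iff)
  qed
  then show ?thesis by auto
qed

lemma weight_add_row:
  "(2::real) ^ card (special_entries (Suc n) (add_row n k a)) =
    row_weight n k (row_of n a) * 2 ^ card (special_entries n a)"
proof -
  let ?R = "{j \<in> {1..row_length n}. k j < row_of n a j \<and>
      (j < row_length (Suc n) \<longrightarrow> row_of n a j < k (Suc j))}"
  have "finite (special_entries n a)"
    by (rule finite_subset[OF _ finite_hmt_positions[of n]]) (auto simp: special_entries_def)
  moreover have "special_entries n a \<inter> (\<lambda>j. (n, j)) ` ?R = {}"
    by (auto simp: special_entries_def hmt_positions_iff)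
  ultimately have "card (special_entries (Suc n) (add_row n k a)) =
      card (special_entries n a) + card ?R"
    unfolding special_entries_add_row by (simp add: card_Un_disjoint card_image inj_on_def)
  moreover have "row_weight n k (row_of n a) = 2 ^ card ?R"
    unfolding row_weight_def by (simp add: prod.If_cases Int_def)
  ultimately show ?thesis by (simp add: power_add mult.commute)
qed

lemma halved_monotone_triangle_add_row:
  assumes k: "increasing_row (row_length (Suc n)) k" and a: "halved_monotone_triangle n a"
    and ge: "\<And>j. j \<in> {1..row_length n} \<Longrightarrow> k j \<le> a (n, j)"
    and le: "\<And>j. j \<in> {1..row_length n} \<Longrightarrow> j < row_length (Suc n) \<Longrightarrow> a (n, j) \<le> k (Suc j)"
  shows "halved_monotone_triangle (Suc n) (add_row n k a)"
  unfolding halved_monotone_triangle_def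
proof (intro conjI allI impI; (elim conjE)?)
  show "add_row n k a \<in> extensional (hmt_positions (Suc n))"
    by (simp add: add_row_def)
next
  fix i j assume ij: "(i, j) \<in> hmt_positions (Suc n)" "(i, j + 1) \<in> hmt_positions (Suc n)"
  show "add_row n k a (i, j) < add_row n k a (i, j + 1)"
  proof (cases "i = Suc n")
    case True
    then show ?thesis using ij k by (auto simp: add_row_bottom hmt_positions_iff increasing_row_def)
  next
    case False
    then have "(i, j) \<in> hmt_positions n" "(i, j + 1) \<in> hmt_positions n"
      using ij by (auto simp: hmt_positions_iff)
    then show ?thesis using a by (simp add: add_row_above halved_monotone_triangle_def)
  qed
next
  fix i j assume ij: "(i, j) \<in> hmt_positions (Suc n)" "i < Suc n"
  show "add_row n k a (i + 1, j) \<le> add_row n k a (i, j)"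
  proof (cases "i = n")
    case True
    then show ?thesis using ij ge[of j] row_length_mono[of n "Suc n"]
      by (auto simp: add_row_bottom add_row_above hmt_positions_iff)
  next
    case False
    then have "(i, j) \<in> hmt_positions n" "(i + 1, j) \<in> hmt_positions n" "i < n"
      using ij row_length_mono[of i "Suc i"] by (auto simp: hmt_positions_iff)
    then show ?thesis using a by (simp add: add_row_above halved_monotone_triangle_def)
  qed
next
  fix i j assume ij: "(i, j) \<in> hmt_positions (Suc n)" "i < Suc n"
    "(i + 1, j + 1) \<in> hmt_positions (Suc n)"
  show "add_row n k a (i, j) \<le> add_row n k a (i + 1, j + 1)"
  proof (cases "i = n")
    case True
    then show ?thesis using ij le[of j]
      by (auto simp: add_row_bottom add_row_above hmt_positions_iff)
  next
    case False
    then have "(i, j) \<in> hmt_positions n" "(i + 1, j + 1) \<in> hmt_positions n" "i < n"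
      using ij by (auto simp: hmt_positions_iff)
    then show ?thesis using a by (simp add: add_row_above halved_monotone_triangle_def)
  qed
qed

lemma halved_monotone_triangle_remove_row:
  assumes "halved_monotone_triangle (Suc n) a"
  shows "halved_monotone_triangle n (restrict a (hmt_positions n))"
proof -
  have "(i + 1, j) \<in> hmt_positions n" if "(i, j) \<in> hmt_positions n" "i < n" for i j
    using that row_length_mono[of i "Suc i"] by (auto simp: hmt_positions_iff)
  then show ?thesis
    using assms by (auto simp: halved_monotone_triangle_def hmt_positions_Suc_iff)
qed

text \<open>A triangle is recovered from its bottom row \<open>k\<close> and the triangle above it.
  The row \<open>l\<close> is kept as a separate component so that the sum can be grouped by
  it.\<close>

lemma bounded_hmts_Suc_bij:
  assumes k: "increasing_row (row_length (Suc n)) k"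
    and k_le: "\<And>j. j \<in> {1..row_length (Suc n)} \<Longrightarrow> k j \<le> b"
  shows "bij_betw (\<lambda>(l, a). add_row n k a)
    (SIGMA l:{l \<in> interlacing_rows n k b. increasing_row (row_length n) l}. bounded_hmts n l b)
    (bounded_hmts (Suc n) k b)"
proof (rule bij_betw_byWitness[where f' = "\<lambda>a. (row_of n a, restrict a (hmt_positions n))"];
    (intro ballI image_subsetI)?; (elim SigmaE)?; (simp only: case_prod_conv)?)
  have pos: "(n, j) \<in> hmt_positions n" if "j \<in> {1..row_length n}" for j
    using that by (cases n) (auto simp: hmt_positions_iff row_length_def)
  fix l a
  assume l: "l \<in> {l \<in> interlacing_rows n k b. increasing_row (row_length n) l}"
    and a: "a \<in> bounded_hmts n l b"
  have bottom: "a (n, j) = l j" if "j \<in> {1..row_length n}" for j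
    using a that by (simp add: bounded_hmts_def)
  have "row_of n (add_row n k a) = l"
    using l bottom
    by (auto simp: row_of_def add_row_above pos interlacing_rows_def PiE_def extensional_def fun_eq_iff)
  moreover have "restrict (add_row n k a) (hmt_positions n) = a"
    using a by (auto simp: fun_eq_iff add_row_above bounded_hmts_def halved_monotone_triangle_def
        extensional_def)
  ultimately show "(row_of n (add_row n k a), restrict (add_row n k a) (hmt_positions n)) = (l, a)"
    by simp
  have range: "l j \<in> {k j..if j < row_length (Suc n) then k (Suc j) else b}"
    if "j \<in> {1..row_length n}" for j
    using l that unfolding interlacing_rows_def by (blast dest: PiE_mem)
  have "halved_monotone_triangle (Suc n) (add_row n k a)"
  proof (rule halved_monotone_triangle_add_row[OF k])
    show "halved_monotone_triangle n a" using a by (simp add: bounded_hmts_def)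
  qed (use range bottom in force)+
  moreover have "add_row n k a p \<le> b" if "p \<in> hmt_positions (Suc n)" for p
    using that a k_le
    by (cases p) (auto simp: hmt_positions_Suc_iff add_row_above add_row_bottom bounded_hmts_def)
  ultimately show "add_row n k a \<in> bounded_hmts (Suc n) k b"
    by (simp add: bounded_hmts_def add_row_bottom)
next
  have pos: "(n, j) \<in> hmt_positions n" if "j \<in> {1..row_length n}" for j
    using that by (cases n) (auto simp: hmt_positions_iff row_length_def)
  fix a assume a: "a \<in> bounded_hmts (Suc n) k b"
  then have hmt: "halved_monotone_triangle (Suc n) a" and le: "\<And>p. p \<in> hmt_positions (Suc n) \<Longrightarrow> a p \<le> b"
    and bottom: "\<And>j. j \<in> {1..row_length (Suc n)} \<Longrightarrow> a (Suc n, j) = k j"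
    by (auto simp: bounded_hmts_def)
  show "add_row n k (restrict a (hmt_positions n)) = a"
  proof
    fix p
    show "add_row n k (restrict a (hmt_positions n)) p = a p"
    proof (cases "p \<in> hmt_positions (Suc n)")
      case True
      then show ?thesis
        using bottom by (cases p) (auto simp: hmt_positions_Suc_iff add_row_above add_row_bottom)
    next
      case False
      then show ?thesis
        using hmt by (cases p) (auto simp: add_row_def halved_monotone_triangle_def extensional_def)
    qed
  qed
  have ge: "k j \<le> a (n, j)" if "j \<in> {1..row_length n}" for j
  proof -
    have "a (n + 1, j) \<le> a (n, j)"
      using hmt pos[OF that] unfolding halved_monotone_triangle_def hmt_positions_Suc_iff by blast
    then show ?thesis using bottom[of j] that row_length_mono[of n "Suc n"] by simp
  qed
  have upper: "a (n, j) \<le> k (Suc j)" if "j \<in> {1..row_length n}" "j < row_length (Suc n)" for j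
  proof -
    have "a (n, j) \<le> a (n + 1, j + 1)"
      using hmt pos[OF that(1)] that unfolding halved_monotone_triangle_def hmt_positions_Suc_iff
      by simp
    then show ?thesis using bottom[of "Suc j"] that by simp
  qed
  \<comment> \<open>A last entry without right neighbour below lies in its range because all entries
    are at most \<open>b\<close>.\<close>
  have "row_of n a \<in> interlacing_rows n k b"
    using ge upper le pos by (auto simp: interlacing_rows_def row_of_def hmt_positions_Suc_iff)
  moreover have "increasing_row (row_length n) (row_of n a)"
    using hmt pos
    by (auto simp: increasing_row_def row_of_def halved_monotone_triangle_def hmt_positions_Suc_iff)
  moreover have "restrict a (hmt_positions n) \<in> bounded_hmts n (row_of n a) b"
    using halved_monotone_triangle_remove_row[OF hmt] le pos
    by (auto simp: bounded_hmts_def row_of_def hmt_positions_Suc_iff)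
  ultimately show "(row_of n a, restrict a (hmt_positions n)) \<in>
      (SIGMA l:{l \<in> interlacing_rows n k b. increasing_row (row_length n) l}. bounded_hmts n l b)"
    by simp
qed

lemma finite_interlacing_rows: "finite (interlacing_rows n k b)"
  unfolding interlacing_rows_def by (intro finite_PiE) auto

text \<open>Base of the induction over the order: there are no positions, and extensionality fixes
  the array.\<close>

lemma bounded_hmts_0: "bounded_hmts 0 k b = {\<lambda>_. undefined}"
  by (auto simp: bounded_hmts_def halved_monotone_triangle_def hmt_positions_def row_length_def
      extensional_def)

text \<open>Passes the bound \<open>b\<close> to the row above, so that the induction hypotheses
  apply to it.\<close>

lemma interlacing_rows_le:
  assumes "\<And>j. j \<in> {1..row_length (Suc n)} \<Longrightarrow> k j \<le> b"
    and "l \<in> interlacing_rows n k b" and "j \<in> {1..row_length n}"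
  shows "l j \<le> b"
proof -
  have "l j \<le> (if j < row_length (Suc n) then k (Suc j) else b)"
    using assms(2,3) unfolding interlacing_rows_def by (auto dest: PiE_mem)
  then show ?thesis using assms(1)[of "Suc j"] by (auto split: if_splits)
qed

text \<open>By induction, there are finitely many interlacing rows and finitely many triangles above
  each. This justifies regrouping the weighted sum.\<close>

lemma finite_bounded_hmts:
  assumes "increasing_row (row_length n) k" and "\<And>j. j \<in> {1..row_length n} \<Longrightarrow> k j \<le> b"
  shows "finite (bounded_hmts n k b)"
  using assms
proof (induction n arbitrary: k)
  case 0
  show ?case by (simp add: bounded_hmts_0)
next
  case (Suc n)
  have "finite (SIGMA l:{l \<in> interlacing_rows n k b. increasing_row (row_length n) l}.
      bounded_hmts n l b)"
    using interlacing_rows_le[of n k b, OF Suc.prems(2)]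
    by (intro finite_SigmaI Suc.IH) (auto intro: finite_subset[OF _ finite_interlacing_rows])
  then show ?case
    using bij_betw_finite[OF bounded_hmts_Suc_bij[OF Suc.prems]] by simp
qed

section \<open>The product formulas\<close>

text \<open>Reindexing by \<open>bounded_hmts_Suc_bij\<close> sorts the triangles by their second
  lowest row \<open>l\<close>. The weight gained by adding \<open>k\<close> depends on
  \<open>l\<close> alone and leaves the inner sum.\<close>

lemma sum_bounded_hmts_Suc:
  assumes k: "increasing_row (row_length (Suc n)) k"
    and k_le: "\<And>j. j \<in> {1..row_length (Suc n)} \<Longrightarrow> k j \<le> b"
  shows "(\<Sum>a\<in>bounded_hmts (Suc n) k b. (2::real) ^ card (special_entries (Suc n) a)) =
    (\<Sum>l | l \<in> interlacing_rows n k b \<and> increasing_row (row_length n) l.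
      row_weight n k l * (\<Sum>a\<in>bounded_hmts n l b. 2 ^ card (special_entries n a)))"
proof -
  let ?R = "{l \<in> interlacing_rows n k b. increasing_row (row_length n) l}"
  have weight: "row_weight n k (row_of n a) = row_weight n k l" if "a \<in> bounded_hmts n l b" for a l
    using that by (auto simp: row_weight_def row_of_def bounded_hmts_def intro!: prod.cong)
  have "(\<Sum>a\<in>bounded_hmts (Suc n) k b. (2::real) ^ card (special_entries (Suc n) a)) =
      (\<Sum>(l, a)\<in>(SIGMA l:?R. bounded_hmts n l b). 2 ^ card (special_entries (Suc n) (add_row n k a)))"
    by (subst sum.reindex_bij_betw[OF bounded_hmts_Suc_bij[OF assms], symmetric])
      (simp_all add: case_prod_unfold)
  also have "\<dots> = (\<Sum>(l, a)\<in>(SIGMA l:?R. bounded_hmts n l b).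
      row_weight n k l * 2 ^ card (special_entries n a))"
    by (rule sum.cong) (auto simp: weight_add_row weight)
  also have "\<dots> = (\<Sum>l\<in>?R. \<Sum>a\<in>bounded_hmts n l b. row_weight n k l * 2 ^ card (special_entries n a))"
    using interlacing_rows_le[of n k b, OF k_le]
    by (intro sum.Sigma[symmetric]) (auto simp: finite_interlacing_rows intro!: finite_bounded_hmts)
  finally show ?thesis by (simp add: sum_distrib_left)
qed

section \<open>Normalising constants and their ratios\<close>

definition odd_constant :: "nat \<Rightarrow> real" where
  "odd_constant m =
    4 ^ (m choose 2) / (\<Prod>(i, j)\<in>index_pairs m. (real j - real i) * (real i + real j - 1))"

text \<open>The power \<open>2 ^ m\<close> arises because each linear factor of the even formula is
  twice a centred entry, and \<open>fact m\<close> collects the denominators of these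
  factors.\<close>

definition even_constant :: "nat \<Rightarrow> real" where
  "even_constant m =
    4 ^ (m choose 2) * 2 ^ m / ((\<Prod>(i, j)\<in>index_pairs m. (real j - real i) * (real i + real j)) * fact m)"

lemma prod_shift_fact: "fact p * (\<Prod>i\<in>{1..q}. real i + real p) = fact (p + q)"
proof (induction q)
  case 0
  show ?case by simp
next
  case (Suc q)
  have "fact p * (\<Prod>i\<in>{1..Suc q}. real i + real p) =
      fact p * (\<Prod>i\<in>{1..q}. real i + real p) * (real (Suc q) + real p)"
    by simp
  then show ?case unfolding Suc.IH by (simp add: algebra_simps)
qed

lemma prod_reflect_fact: "(\<Prod>i\<in>{1..m}. real (Suc m) - real i) = fact m"
proof -
  have "(\<Prod>i\<in>{1..m}. real (Suc m) - real i) = (\<Prod>i\<in>{1..m}. real i)"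
    by (rule prod.reindex_bij_witness[of _ "\<lambda>i. Suc m - i" "\<lambda>i. Suc m - i"]) (auto simp: of_nat_diff)
  then show ?thesis by (simp add: fact_prod)
qed

lemma prod_odd_fact: "(\<Prod>i<m. 2 * real i + 1) * (2 ^ m * fact m) = fact (2 * m)"
proof (induction m)
  case 0
  show ?case by simp
next
  case (Suc m)
  have "(\<Prod>i<Suc m. 2 * real i + 1) * (2 ^ Suc m * fact (Suc m)) =
      (\<Prod>i<m. 2 * real i + 1) * (2 ^ m * fact m) * ((2 * real m + 1) * (2 * real m + 2))"
    by (simp add: algebra_simps)
  then show ?case unfolding Suc.IH by (simp add: algebra_simps)
qed

lemma prod_even_fact: "(\<Prod>i<m. 2 * real i + 2) = 2 ^ m * fact m"
  by (induction m) (simp_all add: algebra_simps)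

text \<open>The new pairs \<open>(i, Suc m)\<close> contribute \<open>fact m\<close> from the
  differences and \<open>fact (2 * m) / fact m\<close> from the sums.\<close>

lemma odd_denominator_Suc:
  "(\<Prod>(i, j)\<in>index_pairs (Suc m). (real j - real i) * (real i + real j - 1)) =
    (\<Prod>(i, j)\<in>index_pairs m. (real j - real i) * (real i + real j - 1)) * fact (2 * m)"
  using prod_shift_fact[of m m]
  by (simp add: prod_index_pairs_Suc prod.distrib prod_reflect_fact[simplified] mult_2)

text \<open>As in the odd case, but the sums now contribute
  \<open>fact (2 * m + 1) / fact (Suc m)\<close>, which leaves the factor \<open>real m + 1\<close>
  on the left.\<close>

lemma even_denominator_Suc:
  "(\<Prod>(i, j)\<in>index_pairs (Suc m). (real j - real i) * (real i + real j)) * (real m + 1) =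
    (\<Prod>(i, j)\<in>index_pairs m. (real j - real i) * (real i + real j)) * fact (2 * m + 1)"
proof -
  have "fact m * (\<Prod>i\<in>{1..m}. real i + real (Suc m)) * (real m + 1) = fact (2 * m + 1)"
  proof -
    have "2 * m + 1 = Suc m + m" by simp
    then have "fact (2 * m + 1) = fact (Suc m) * (\<Prod>i\<in>{1..m}. real i + real (Suc m))"
      by (simp only: prod_shift_fact)
    then show ?thesis by (simp only: fact_Suc of_nat_Suc mult_ac add.commute)
  qed
  then show ?thesis
    by (simp add: prod_index_pairs_Suc prod.distrib prod_reflect_fact[simplified] mult.assoc)
qed

lemma denominators_nonzero:
  "(\<Prod>(i, j)\<in>index_pairs m. (real j - real i) * (real i + real j - 1)) \<noteq> 0"
  "(\<Prod>(i, j)\<in>index_pairs m. (real j - real i) * (real i + real j)) \<noteq> 0"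
  unfolding prod_zero_iff[OF finite_index_pairs] by (auto simp: index_pairs_def)

text \<open>Both sides gain the factor \<open>fact (2 * m + 1)\<close> when \<open>m\<close>
  increases by 1.\<close>

lemma odd_even_denominator:
  "(\<Prod>(i, j)\<in>index_pairs m. (real j - real i) * (real i + real j - 1)) * (\<Prod>i<m. 2 * real i + 1) =
    (\<Prod>(i, j)\<in>index_pairs m. (real j - real i) * (real i + real j)) * fact m"
    (is "?A m * ?O m = ?B m * fact m")
proof (induction m)
  case 0
  show ?case by simp
next
  case (Suc m)
  have "?A (Suc m) * ?O (Suc m) = ?A m * ?O m * fact (2 * m + 1)"
    by (simp add: odd_denominator_Suc mult_ac)
  also have "\<dots> = ?B m * fact (2 * m + 1) * fact m"
    unfolding Suc.IH by (simp only: mult_ac)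
  also have "\<dots> = ?B (Suc m) * fact (Suc m)"
    unfolding even_denominator_Suc[symmetric] by (simp add: mult_ac)
  finally show ?case .
qed

lemma prod_odd_nonzero: "(\<Prod>i<m. 2 * real i + 1) \<noteq> 0"
  using prod_odd_fact[of m] by (metis fact_nonzero mult_zero_left)

text \<open>The ratio of constants demanded by \<open>even_row_summation\<close>: the leading
  coefficients on one side against \<open>2 ^ m\<close> on the other.\<close>

lemma even_constant_eq: "even_constant m * (\<Prod>i<m. 2 * real i + 1) = odd_constant m * 2 ^ m"
  unfolding even_constant_def odd_constant_def odd_even_denominator[symmetric]
  using prod_odd_nonzero[of m] by simp

text \<open>The counterpart for \<open>odd_row_summation\<close>. The binomial exponent grows by
  \<open>m\<close>, which supplies two factors \<open>2 ^ m\<close>.\<close>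

lemma odd_constant_Suc: "odd_constant (Suc m) * (\<Prod>i<m. 2 * real i + 2) = even_constant m * 2 ^ m"
proof -
  let ?A = "\<lambda>m. \<Prod>(i, j)\<in>index_pairs m. (real j - real i) * (real i + real j - 1)"
  let ?B = "\<lambda>m. \<Prod>(i, j)\<in>index_pairs m. (real j - real i) * (real i + real j)"
  \<comment> \<open>The new factor \<open>fact (2 * m)\<close> contains the product of the odd
    numbers, which turns the odd denominator into the even one.\<close>
  have A: "?A (Suc m) = ?B m * fact m * (2 ^ m * fact m)"
    unfolding odd_denominator_Suc prod_odd_fact[symmetric] odd_even_denominator[symmetric]
    by (simp only: mult.assoc)
  have "(4::real) ^ m = 2 ^ m * 2 ^ m"
    by (simp flip: power_mult_distrib)
  moreover have "Suc m choose 2 = (m choose 2) + m"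
    by (simp add: numeral_2_eq_2)
  ultimately show ?thesis
    using denominators_nonzero(2)[of m]
    unfolding odd_constant_def even_constant_def A prod_even_fact
    by (simp add: power_add field_simps)
qed

section \<open>Induction over the rows\<close>

definition row_product :: "nat \<Rightarrow> int \<Rightarrow> (nat \<Rightarrow> int) \<Rightarrow> real" where
  "row_product n b l =
    (\<Prod>(i, j)\<in>index_pairs (row_length n). (centred b (l i))\<^sup>2 - (centred b (l j))\<^sup>2) *
    (if even n then \<Prod>j\<in>{1..row_length n}. centred b (l j) else 1)"

text \<open>Interlacing places \<open>k (Suc j)\<close> between \<open>l j\<close> and
  \<open>l (Suc j)\<close>, so strict increase can fail only through equal neighbours, whose factor
  vanishes. Rows that are not strictly increasing can therefore be included in the sum.\<close>

lemma row_product_eq_0: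
  assumes l: "l \<in> interlacing_rows n k b" "\<not> increasing_row (row_length n) l"
  shows "row_product n b l = 0"
proof -
  obtain j where j: "1 \<le> j" "j < row_length n" "l (Suc j) \<le> l j"
    using l(2) by (auto simp: increasing_row_def not_less)
  have "row_length n \<le> row_length (Suc n)" by (simp add: row_length_mono)
  moreover have "l i \<in> {k i..if i < row_length (Suc n) then k (Suc i) else b}"
    if "i \<in> {1..row_length n}" for i
    using l(1) that unfolding interlacing_rows_def by (blast dest: PiE_mem)
  from this[of j] this[of "Suc j"] j have "l j \<le> (if j < row_length (Suc n) then k (Suc j) else b)"
    and "k (Suc j) \<le> l (Suc j)" by simp_all
  ultimately have "l j \<le> l (Suc j)" using j by simp
  with j have "l j = l (Suc j)" by simp
  moreover have "(j, Suc j) \<in> index_pairs (row_length n)"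
    using j by (simp add: index_pairs_def)
  ultimately have "(\<Prod>(i, j)\<in>index_pairs (row_length n). (centred b (l i))\<^sup>2 - (centred b (l j))\<^sup>2) = 0"
    by (intro prod_zero finite_index_pairs bexI[of _ "(j, Suc j)"]) auto
  then show ?thesis by (simp add: row_product_def)
qed

definition row_constant :: "nat \<Rightarrow> real" where
  "row_constant n = (if even n then even_constant (row_length n) else odd_constant (row_length n))"

text \<open>Combines a row summation \<open>p * s = q * t\<close> with the matching ratio of
  constants \<open>c' * p = c * q\<close>.\<close>

lemma cancel_proportional:
  fixes c c' p q s t :: real
  assumes "p * s = q * t" and "p \<noteq> 0" and "c' * p = c * q"
  shows "c * s = c' * t"
proof -
  have "p * (c * s) = c * q * t" using assms(1) by (simp add: mult_ac)
  also have "\<dots> = p * (c' * t)" unfolding assms(3)[symmetric] by (simp add: mult_ac)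
  finally show ?thesis using assms(2) by simp
qed

text \<open>If \<open>n\<close> is even, the new row is one entry longer and
  \<open>odd_row_summation\<close> applies. If \<open>n\<close> is odd, the lengths agree and
  \<open>even_row_summation\<close> applies.\<close>

lemma row_summation:
  assumes k: "increasing_row (row_length (Suc n)) k"
    and k_le: "\<And>j. j \<in> {1..row_length (Suc n)} \<Longrightarrow> k j \<le> b"
  shows "row_constant n * (\<Sum>l\<in>interlacing_rows n k b. row_weight n k l * row_product n b l) =
    row_constant (Suc n) * row_product (Suc n) b k" (is "_ * ?S = _")
proof (cases "even n")
  case True
  define m where "m = row_length n"
  have m': "row_length (Suc n) = Suc m" using True by (auto simp: m_def row_length_def)
  have inc: "k j < k (Suc j)" if "1 \<le> j" "j \<le> m" for j
    using k that by (simp add: m' increasing_row_def)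
  \<comment> \<open>Every entry of the shorter upper row has a right neighbour below, so the
    alternative \<open>b\<close> does not occur.\<close>
  have rows: "interlacing_rows n k b = (\<Pi>\<^sub>E j\<in>{1..m}. {k j..k (Suc j)})"
    unfolding interlacing_rows_def m' m_def[symmetric] by (intro PiE_cong) auto
  have weight: "row_weight n k l = (\<Prod>j\<in>{1..m}. if k j < l j \<and> l j < k (Suc j) then 2 else 1)" for l
    unfolding row_weight_def m' m_def[symmetric] by (intro prod.cong) auto
  have "(\<Prod>i<m. 2 * real i + 2) * ?S = 2 ^ m * row_product (Suc n) b k"
    using odd_row_summation[of m k b, OF inc] True
    by (simp add: rows weight row_product_def m' flip: m_def)
  moreover have "(\<Prod>i<m. 2 * real i + 2) \<noteq> 0"
    unfolding prod_even_fact by simp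
  moreover have "row_constant (Suc n) * (\<Prod>i<m. 2 * real i + 2) = row_constant n * 2 ^ m"
    using odd_constant_Suc[of m] True by (simp add: row_constant_def m' flip: m_def)
  ultimately show ?thesis by (rule cancel_proportional)
next
  case False
  define m where "m = row_length n"
  have m': "row_length (Suc n) = m" using False by (auto simp: m_def row_length_def elim: oddE)
  have inc: "k j < k (Suc j)" if "1 \<le> j" "j < m" for j
    using k that by (simp add: m' increasing_row_def)
  have "(\<Prod>i<m. 2 * real i + 1) * ?S = 2 ^ m * row_product (Suc n) b k"
    using even_row_summation[of m k b, OF inc] k_le False
    by (simp add: interlacing_rows_def row_weight_def row_product_def m' flip: m_def)
  moreover have "(\<Prod>i<m. 2 * real i + 1) \<noteq> 0"
    by (rule prod_odd_nonzero)
  moreover have "row_constant (Suc n) * (\<Prod>i<m. 2 * real i + 1) = row_constant n * 2 ^ m"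
    using even_constant_eq[of m] False by (simp add: row_constant_def m' flip: m_def)
  ultimately show ?thesis by (rule cancel_proportional)
qed

lemma sum_bounded_hmts:
  assumes "increasing_row (row_length n) k" and "\<And>j. j \<in> {1..row_length n} \<Longrightarrow> k j \<le> b"
  shows "(\<Sum>a\<in>bounded_hmts n k b. (2::real) ^ card (special_entries n a)) =
    row_constant n * row_product n b k"
  using assms
proof (induction n arbitrary: k)
  case 0
  have "special_entries 0 a = {}" for a
    by (auto simp: special_entries_def hmt_positions_def)
  then show ?case
    by (simp add: bounded_hmts_0 row_constant_def even_constant_def row_product_def row_length_def
        binomial_eq_0)
next
  case (Suc n)
  let ?R = "{l. l \<in> interlacing_rows n k b \<and> increasing_row (row_length n) l}"
  have "(\<Sum>a\<in>bounded_hmts (Suc n) k b. (2::real) ^ card (special_entries (Suc n) a)) =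
      (\<Sum>l\<in>?R. row_weight n k l * (\<Sum>a\<in>bounded_hmts n l b. 2 ^ card (special_entries n a)))"
    by (rule sum_bounded_hmts_Suc[OF Suc.prems])
  also have "\<dots> = (\<Sum>l\<in>?R. row_weight n k l * (row_constant n * row_product n b l))"
  proof (rule sum.cong[OF refl])
    fix l assume l: "l \<in> ?R"
    then have "(\<Sum>a\<in>bounded_hmts n l b. 2 ^ card (special_entries n a)) =
        row_constant n * row_product n b l"
      using interlacing_rows_le[of n k b l, OF Suc.prems(2)] by (intro Suc.IH) auto
    then show "row_weight n k l * (\<Sum>a\<in>bounded_hmts n l b. 2 ^ card (special_entries n a)) =
        row_weight n k l * (row_constant n * row_product n b l)"
      by simp
  qed
  \<comment> \<open>The rows added here contribute zero by \<open>row_product_eq_0\<close>, and the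
    range of summation becomes a product of intervals.\<close>
  also have "\<dots> = (\<Sum>l\<in>interlacing_rows n k b. row_weight n k l * (row_constant n * row_product n b l))"
    using row_product_eq_0
    by (intro sum.mono_neutral_left finite_interlacing_rows) auto
  also have "\<dots> = row_constant n * (\<Sum>l\<in>interlacing_rows n k b. row_weight n k l * row_product n b l)"
    by (simp add: sum_distrib_left mult_ac)
  also have "\<dots> = row_constant (Suc n) * row_product (Suc n) b k"
    by (rule row_summation[OF Suc.prems])
  finally show ?case .
qed

section \<open>Return to the stated factors\<close>

text \<open>Factoring the difference of squares, the difference of the centred values is
  \<open>t - s\<close> and their sum is \<open>2 * b + 1 - s - t\<close>.\<close>

lemma centred_square_diff:
  "(centred b s)\<^sup>2 - (centred b t)\<^sup>2 =
    (real_of_int t - real_of_int s) * (2 * real_of_int b + 1 - real_of_int s - real_of_int t)"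
  by (simp add: centred_def power2_eq_square algebra_simps)

theorem theoremA1:
  fixes n :: nat and b :: int and k :: "nat \<Rightarrow> int"
  assumes "n \<ge> 1"
    and "strict_mono_on {1..row_length n} k"
    and "k (row_length n) \<le> b"
  shows "(odd n \<longrightarrow>
      (\<Sum>a\<in>bounded_hmts n k b. (2::real) ^ card (special_entries n a)) =
        4 ^ (((n + 1) div 2) choose 2) *
        (\<Prod>(i, j)\<in>{(i, j). 1 \<le> i \<and> i < j \<and> j \<le> (n + 1) div 2}.
           (real_of_int (k j) - real_of_int (k i)) *
           (2 * real_of_int b + 1 - real_of_int (k i) - real_of_int (k j)) /
           ((real j - real i) * (real i + real j - 1)))) \<and>
    (even n \<longrightarrow>
      (\<Sum>a\<in>bounded_hmts n k b. (2::real) ^ card (special_entries n a)) =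
        4 ^ ((n div 2) choose 2) *
        (\<Prod>(i, j)\<in>{(i, j). 1 \<le> i \<and> i < j \<and> j \<le> n div 2}.
           (real_of_int (k j) - real_of_int (k i)) *
           (2 * real_of_int b + 1 - real_of_int (k i) - real_of_int (k j)) /
           ((real j - real i) * (real i + real j))) *
        (\<Prod>i\<in>{1..n div 2}. (2 * real_of_int b + 1 - 2 * real_of_int (k i)) / real i))"
proof -
  have "increasing_row (row_length n) k"
    using assms(2) by (auto simp: increasing_row_def strict_mono_on_def)
  moreover have "k j \<le> b" if "j \<in> {1..row_length n}" for j
  proof -
    have "k j \<le> k (row_length n)"
      using strict_mono_on_leD[OF assms(2)] that by auto
    then show ?thesis using assms(3) by simp
  qed
  ultimately have sum: "(\<Sum>a\<in>bounded_hmts n k b. (2::real) ^ card (special_entries n a)) =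
      row_constant n * row_product n b k"
    by (rule sum_bounded_hmts)
  \<comment> \<open>The denominator \<open>d\<close> is left open so that the same rewriting serves
    both parities.\<close>
  have split: "(\<Prod>(i, j)\<in>index_pairs m. (real_of_int (k j) - real_of_int (k i)) *
        (2 * real_of_int b + 1 - real_of_int (k i) - real_of_int (k j)) / d i j) =
      (\<Prod>(i, j)\<in>index_pairs m. (centred b (k i))\<^sup>2 - (centred b (k j))\<^sup>2) /
      (\<Prod>(i, j)\<in>index_pairs m. d i j)" for d :: "nat \<Rightarrow> nat \<Rightarrow> real" and m
    unfolding centred_square_diff by (simp add: case_prod_unfold prod_dividef)
  have linear: "(\<Prod>i\<in>{1..m}. (2 * real_of_int b + 1 - 2 * real_of_int (k i)) / real i) =
      2 ^ m * (\<Prod>i\<in>{1..m}. centred b (k i)) / fact m" for m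
  proof -
    have "2 * real_of_int b + 1 - 2 * real_of_int (k i) = 2 * centred b (k i)" for i
      by (simp add: centred_def)
    then show ?thesis by (simp add: prod_dividef prod.distrib fact_prod)
  qed
  show ?thesis
  proof (intro conjI impI)
    assume "odd n"
    then show "(\<Sum>a\<in>bounded_hmts n k b. (2::real) ^ card (special_entries n a)) =
        4 ^ (((n + 1) div 2) choose 2) *
        (\<Prod>(i, j)\<in>{(i, j). 1 \<le> i \<and> i < j \<and> j \<le> (n + 1) div 2}.
           (real_of_int (k j) - real_of_int (k i)) *
           (2 * real_of_int b + 1 - real_of_int (k i) - real_of_int (k j)) /
           ((real j - real i) * (real i + real j - 1)))"
      unfolding sum index_pairs_def[symmetric] split
      by (simp add: row_constant_def odd_constant_def row_product_def row_length_def)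
  next
    assume "even n"
    then have "row_length n = n div 2" by (auto simp: row_length_def)
    with \<open>even n\<close> show "(\<Sum>a\<in>bounded_hmts n k b. (2::real) ^ card (special_entries n a)) =
        4 ^ ((n div 2) choose 2) *
        (\<Prod>(i, j)\<in>{(i, j). 1 \<le> i \<and> i < j \<and> j \<le> n div 2}.
           (real_of_int (k j) - real_of_int (k i)) *
           (2 * real_of_int b + 1 - real_of_int (k i) - real_of_int (k j)) /
           ((real j - real i) * (real i + real j))) *
        (\<Prod>i\<in>{1..n div 2}. (2 * real_of_int b + 1 - 2 * real_of_int (k i)) / real i)"
      unfolding sum index_pairs_def[symmetric] split linear
      by (simp add: row_constant_def even_constant_def row_product_def)
  qed
qed

end
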